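(* Let $A$ be a concept name, $R$ a role name and $a$ an individual name, and let $\mathcal{K}_2$ be the fuzzy knowledge base consisting of the axioms (1) $\langle a\colon A = 0.5\rangle$; (2) $\top \sqsubseteq \exists R.\top$; (3) $(\forall R.A) \equiv (\exists R.A)$; (4) $A \equiv (\forall R.A) \sqcap (\forall R.A)$. Under the semantics of fuzzy $\mathcal{ALC}$ given by Łukasiewicz fuzzy logic, there is a witnessed interpretation satisfying $\mathcal{K}_2$, but there is no finite interpretation satisfying $\mathcal{K}_2$.
   Context: Syntax. Fix non-empty, enumerable, pairwise disjoint sets of concept names, role names and individual names. Concepts are built by $C,D ::= \top \mid \bot \mid A \mid C\sqcap D \mid C\sqcup D \mid \neg C \mid \forall R.C \mid \exists R.C$ with $A$ a concept name and $R$ a role name. A fuzzy knowledge base (KB) is a pair of a finite fuzzy ABox (axioms $\langle a\colon C\geq\alpha\rangle$, $\langle a\colon C\leq\alpha\rangle$, $\langle (a,b)\colon R\geq\alpha\rangle$) and a finite fuzzy TBox (axioms $\langle C\sqsubseteq D\geq\alpha\rangle$), with $a,b$ individual names, $C,D$ concepts, $R$ a role name, and $\alpha\in[0,1]$ rational. Shorthands: $\tau$ stands for $\langle\tau\geq 1\rangle$; $\langle a\colon C=\alpha\rangle$ stands for the two axioms $\langle a\colon C\geq\alpha\rangle$, $\langle a\colon C\leq\alpha\rangle$; $C\equiv D$ stands for the two axioms $\langle C\sqsubseteq D\geq 1\rangle$, $\langle D\sqsubseteq C\geq 1\rangle$. Łukasiewicz operators on $[0,1]$: $x\otimes y=\max\{x+y-1,0\}$,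 $x\oplus y=\min\{x+y,1\}$, $\ominus x=1-x$, $x\Rightarrow y=\min\{1-x+y,1\}$. Semantics. An interpretation (model) $\mathcal{I}$ consists of a non-empty set $\Delta^{\mathcal I}$ (the domain), a function $A^{\mathcal I}:\Delta^{\mathcal I}\to[0,1]$ for each concept name, a function $R^{\mathcal I}:\Delta^{\mathcal I}\times\Delta^{\mathcal I}\to[0,1]$ for each role name, and an element $a^{\mathcal I}\in\Delta^{\mathcal I}$ for each individual name. It extends to all concepts by $\top^{\mathcal I}(x)=1$, $\bot^{\mathcal I}(x)=0$, $(C\sqcap D)^{\mathcal I}(x)=C^{\mathcal I}(x)\otimes D^{\mathcal I}(x)$, $(C\sqcup D)^{\mathcal I}(x)=C^{\mathcal I}(x)\oplus D^{\mathcal I}(x)$, $(\neg C)^{\mathcal I}(x)=\ominus C^{\mathcal I}(x)$, $(\forall R.C)^{\mathcal I}(x)=\inf_{y\in\Delta^{\mathcal I}}(R^{\mathcal I}(x,y)\Rightarrow C^{\mathcal I}(y))$, $(\exists R.C)^{\mathcal I}(x)=\sup_{y\in\Delta^{\mathcal I}}(R^{\mathcal I}(x,y)\otimes C^{\mathcal I}(y))$. Put $(C\sqsubseteq D)^{\mathcal I}=\inf_{x\in\Delta^{\mathcal I}}(C^{\mathcal I}(x)\Rightarrow D^{\mathcal I}(x))$. $\mathcal I$ satisfies $\langle a\colon C\geq\alpha\rangle$ iff $C^{\mathcal I}(a^{\mathcal I})\geq\alpha$; $\langle a\colon C\leq\alpha\rangle$ iff $C^{\mathcal I}(a^{\mathcal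 I})\leq\alpha$; $\langle (a,b)\colon R\geq\alpha\rangle$ iff $R^{\mathcal I}(a^{\mathcal I},b^{\mathcal I})\geq\alpha$; $\langle C\sqsubseteq D\geq\alpha\rangle$ iff $(C\sqsubseteq D)^{\mathcal I}\geq\alpha$. $\mathcal I$ satisfies (is a model of) a KB iff it satisfies all its axioms. $\mathcal I$ is finite iff $\Delta^{\mathcal I}$ is finite. $\mathcal I$ is witnessed iff for all concepts $C,D$, every role name $R$ and every $x\in\Delta^{\mathcal I}$ there are: some $y\in\Delta^{\mathcal I}$ with $(\exists R.C)^{\mathcal I}(x)=R^{\mathcal I}(x,y)\otimes C^{\mathcal I}(y)$; some $y\in\Delta^{\mathcal I}$ with $(\forall R.C)^{\mathcal I}(x)=R^{\mathcal I}(x,y)\Rightarrow C^{\mathcal I}(y)$; and some $y\in\Delta^{\mathcal I}$ with $(C\sqsubseteq D)^{\mathcal I}=C^{\mathcal I}(y)\Rightarrow D^{\mathcal I}(y)$. *)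

theory Defs
  imports Complex_Main "HOL-Library.Countable"
begin

text \<open>Concept, role and individual names are the elements of three types, so the three sets of names
  are non-empty and disjoint; enumerability is the class constraint \<open>countable\<close>, imposed where
  statements are made.\<close>

datatype ('c, 'r) concept =
    CTop
  | CBot
  | CName 'c
  | CAnd "('c, 'r) concept" "('c, 'r) concept"
  | COr "('c, 'r) concept" "('c, 'r) concept"
  | CNot "('c, 'r) concept"
  | CAll 'r "('c, 'r) concept"
  | CEx 'r "('c, 'r) concept"

datatype ('c, 'r, 'i) abox_axiom =
    Concept_ge 'i "('c, 'r) concept" rat
  | Concept_le 'i "('c, 'r) concept" rat
  | Role_ge 'i 'i 'r rat

datatype ('c, 'r) tbox_axiom =
    Subsumed_ge "('c, 'r) concept" "('c, 'r) concept" rat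

type_synonym ('c, 'r, 'i) kb = "('c, 'r, 'i) abox_axiom set \<times> ('c, 'r) tbox_axiom set"

fun abox_degree :: "('c, 'r, 'i) abox_axiom \<Rightarrow> rat" where
  "abox_degree (Concept_ge _ _ \<alpha>) = \<alpha>"
| "abox_degree (Concept_le _ _ \<alpha>) = \<alpha>"
| "abox_degree (Role_ge _ _ _ \<alpha>) = \<alpha>"

fun tbox_degree :: "('c, 'r) tbox_axiom \<Rightarrow> rat" where
  "tbox_degree (Subsumed_ge _ _ \<alpha>) = \<alpha>"

definition fuzzy_kb :: "('c, 'r, 'i) kb \<Rightarrow> bool" where
  "fuzzy_kb K \<longleftrightarrow> finite (fst K) \<and> finite (snd K) \<and>
     (\<forall>\<tau>\<in>fst K. abox_degree \<tau> \<in> {0..1}) \<and> (\<forall>\<tau>\<in>snd K. tbox_degree \<tau> \<in> {0..1})"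

definition Concept_eq :: "'i \<Rightarrow> ('c, 'r) concept \<Rightarrow> rat \<Rightarrow> ('c, 'r, 'i) abox_axiom set" where
  "Concept_eq a C \<alpha> = {Concept_ge a C \<alpha>, Concept_le a C \<alpha>}"

definition Subsumed :: "('c, 'r) concept \<Rightarrow> ('c, 'r) concept \<Rightarrow> ('c, 'r) tbox_axiom set" where
  "Subsumed C D = {Subsumed_ge C D 1}"

definition Equivalent :: "('c, 'r) concept \<Rightarrow> ('c, 'r) concept \<Rightarrow> ('c, 'r) tbox_axiom set" where
  "Equivalent C D = Subsumed C D \<union> Subsumed D C"

definition luk_and :: "real \<Rightarrow> real \<Rightarrow> real" where
  "luk_and x y = max (x + y - 1) 0"

definition luk_or :: "real \<Rightarrow> real \<Rightarrow> real" where
  "luk_or x y = min (x + y) 1"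

definition luk_not :: "real \<Rightarrow> real" where
  "luk_not x = 1 - x"

definition luk_imp :: "real \<Rightarrow> real \<Rightarrow> real" where
  "luk_imp x y = min (1 - x + y) 1"

record ('c, 'r, 'i, 'd) interp =
  Dom :: "'d set"
  CN :: "'c \<Rightarrow> 'd \<Rightarrow> real"
  RN :: "'r \<Rightarrow> 'd \<Rightarrow> 'd \<Rightarrow> real"
  IN :: "'i \<Rightarrow> 'd"

text \<open>The values of \<open>CN\<close> and \<open>RN\<close> outside the domain are irrelevant.\<close>

definition fuzzy_interp :: "('c, 'r, 'i, 'd) interp \<Rightarrow> bool" where
  "fuzzy_interp \<I> \<longleftrightarrow> Dom \<I> \<noteq> {} \<and>
     (\<forall>A. \<forall>x\<in>Dom \<I>. CN \<I> A x \<in> {0..1}) \<and>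
     (\<forall>R. \<forall>x\<in>Dom \<I>. \<forall>y\<in>Dom \<I>. RN \<I> R x y \<in> {0..1}) \<and>
     (\<forall>a. IN \<I> a \<in> Dom \<I>)"

text \<open>For a \<open>fuzzy_interp\<close> the infima and suprema below are over non-empty subsets of the unit
  interval, so the conditionally complete operators on the reals are the intended ones.\<close>

primrec ceval :: "('c, 'r, 'i, 'd) interp \<Rightarrow> ('c, 'r) concept \<Rightarrow> 'd \<Rightarrow> real" where
  "ceval \<I> CTop x = 1"
| "ceval \<I> CBot x = 0"
| "ceval \<I> (CName A) x = CN \<I> A x"
| "ceval \<I> (CAnd C D) x = luk_and (ceval \<I> C x) (ceval \<I> D x)"
| "ceval \<I> (COr C D) x = luk_or (ceval \<I> C x) (ceval \<I> D x)"
| "ceval \<I> (CNot C) x = luk_not (ceval \<I> C x)"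
| "ceval \<I> (CAll R C) x = (INF y\<in>Dom \<I>. luk_imp (RN \<I> R x y) (ceval \<I> C y))"
| "ceval \<I> (CEx R C) x = (SUP y\<in>Dom \<I>. luk_and (RN \<I> R x y) (ceval \<I> C y))"

definition subs_eval :: "('c, 'r, 'i, 'd) interp \<Rightarrow> ('c, 'r) concept \<Rightarrow> ('c, 'r) concept \<Rightarrow> real" where
  "subs_eval \<I> C D = (INF x\<in>Dom \<I>. luk_imp (ceval \<I> C x) (ceval \<I> D x))"

fun sat_abox_axiom :: "('c, 'r, 'i, 'd) interp \<Rightarrow> ('c, 'r, 'i) abox_axiom \<Rightarrow> bool" where
  "sat_abox_axiom \<I> (Concept_ge a C \<alpha>) \<longleftrightarrow> ceval \<I> C (IN \<I> a) \<ge> of_rat \<alpha>"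
| "sat_abox_axiom \<I> (Concept_le a C \<alpha>) \<longleftrightarrow> ceval \<I> C (IN \<I> a) \<le> of_rat \<alpha>"
| "sat_abox_axiom \<I> (Role_ge a b R \<alpha>) \<longleftrightarrow> RN \<I> R (IN \<I> a) (IN \<I> b) \<ge> of_rat \<alpha>"

fun sat_tbox_axiom :: "('c, 'r, 'i, 'd) interp \<Rightarrow> ('c, 'r) tbox_axiom \<Rightarrow> bool" where
  "sat_tbox_axiom \<I> (Subsumed_ge C D \<alpha>) \<longleftrightarrow> subs_eval \<I> C D \<ge> of_rat \<alpha>"

definition satisfies :: "('c, 'r, 'i, 'd) interp \<Rightarrow> ('c, 'r, 'i) kb \<Rightarrow> bool" where
  "satisfies \<I> K \<longleftrightarrow>
     (\<forall>\<tau>\<in>fst K. sat_abox_axiom \<I> \<tau>) \<and> (\<forall>\<tau>\<in>snd K. sat_tbox_axiom \<I> \<tau>)"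

definition finite_interp :: "('c, 'r, 'i, 'd) interp \<Rightarrow> bool" where
  "finite_interp \<I> \<longleftrightarrow> finite (Dom \<I>)"

definition witnessed :: "('c, 'r, 'i, 'd) interp \<Rightarrow> bool" where
  "witnessed \<I> \<longleftrightarrow> (\<forall>C D R. \<forall>x\<in>Dom \<I>.
     (\<exists>y\<in>Dom \<I>. ceval \<I> (CEx R C) x = luk_and (RN \<I> R x y) (ceval \<I> C y)) \<and>
     (\<exists>y\<in>Dom \<I>. ceval \<I> (CAll R C) x = luk_imp (RN \<I> R x y) (ceval \<I> C y)) \<and>
     (\<exists>y\<in>Dom \<I>. subs_eval \<I> C D = luk_imp (ceval \<I> C y) (ceval \<I> D y)))"

definition K2 :: "'c \<Rightarrow> 'r \<Rightarrow> 'i \<Rightarrow> ('c, 'r, 'i) kb" where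
  "K2 A R a =
     (Concept_eq a (CName A) (1/2),
      Subsumed CTop (CEx R CTop) \<union>
      Equivalent (CAll R (CName A)) (CEx R (CName A)) \<union>
      Equivalent (CName A) (CAnd (CAll R (CName A)) (CAll R (CName A))))"

lemma fuzzy_kb_K2: "fuzzy_kb (K2 A R a)"
  by (auto simp: fuzzy_kb_def K2_def Concept_eq_def Subsumed_def Equivalent_def)

end

theory Submission
  imports Defs
begin

text \<open>In a model of \<open>K2\<close> every element \<open>x\<close> has an \<open>R\<close>-successor to degree arbitrarily close to \<open>1\<close>. In a
  finite one the degree \<open>1\<close> is attained at some \<open>y\<close>, and axiom (3) forces \<open>\<forall>R.A\<close> to take the value
  \<open>A y\<close> at \<open>x\<close>, so (4) reads \<open>A x = max (2 * A y - 1) 0\<close>. If \<open>0 < A x < 1\<close> then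
  \<open>A x < A y < 1\<close>, so no element can have the largest value of \<open>A\<close> in the open interval, which is
  met by axiom (1).

  The infinite model is the chain of values \<open>1/2, 3/4, 7/8, \<dots>\<close> closed off by a limit point of value
  \<open>1\<close>. Every concept is continuous at the limit point, and a function on a convergent sequence
  together with its limit attains its infimum; this makes the model witnessed.\<close>

section \<open>Truth values stay in the unit interval\<close>

lemma luk_and_unit: "x \<in> {0..1} \<Longrightarrow> y \<in> {0..1} \<Longrightarrow> luk_and x y \<in> {0..1}"
  by (auto simp: luk_and_def)

lemma luk_imp_unit: "x \<in> {0..1} \<Longrightarrow> y \<in> {0..1} \<Longrightarrow> luk_imp x y \<in> {0..1}"
  by (auto simp: luk_imp_def)

lemma bdd_below_unit:
  fixes f :: "'d \<Rightarrow> real"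
  shows "(\<And>x. x \<in> X \<Longrightarrow> f x \<in> {0..1}) \<Longrightarrow> bdd_below (f ` X)"
  by (rule bdd_belowI2[of _ 0]) auto

lemma bdd_above_unit:
  fixes f :: "'d \<Rightarrow> real"
  shows "(\<And>x. x \<in> X \<Longrightarrow> f x \<in> {0..1}) \<Longrightarrow> bdd_above (f ` X)"
  by (rule bdd_aboveI2[of _ _ 1]) auto

lemma INF_unit:
  fixes f :: "'d \<Rightarrow> real"
  assumes "X \<noteq> {}" "\<And>x. x \<in> X \<Longrightarrow> f x \<in> {0..1}"
  shows "(INF x\<in>X. f x) \<in> {0..1}"
proof -
  obtain x where "x \<in> X" using assms(1) by blast
  then have "(INF x\<in>X. f x) \<le> f x"
    by (intro cINF_lower bdd_below_unit assms(2))
  moreover have "0 \<le> (INF x\<in>X. f x)"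
    using assms by (intro cINF_greatest) auto
  ultimately show ?thesis using assms(2)[OF \<open>x \<in> X\<close>] by auto
qed

lemma SUP_unit:
  fixes f :: "'d \<Rightarrow> real"
  assumes "X \<noteq> {}" "\<And>x. x \<in> X \<Longrightarrow> f x \<in> {0..1}"
  shows "(SUP x\<in>X. f x) \<in> {0..1}"
proof -
  obtain x where "x \<in> X" using assms(1) by blast
  then have "f x \<le> (SUP x\<in>X. f x)"
    by (intro cSUP_upper bdd_above_unit assms(2))
  moreover have "(SUP x\<in>X. f x) \<le> 1"
    using assms by (intro cSUP_least) auto
  ultimately show ?thesis using assms(2)[OF \<open>x \<in> X\<close>] by auto
qed

text \<open>Supplies the bounds without which \<open>INF\<close> and \<open>SUP\<close> over the
  reals could not be compared with their members.\<close>

lemma ceval_unit: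
  assumes "fuzzy_interp \<I>" "x \<in> Dom \<I>"
  shows "ceval \<I> C x \<in> {0..1}"
  using assms(2)
proof (induction C arbitrary: x)
  case (CAll R C)
  then show ?case
    using assms(1) unfolding ceval.simps
    by (intro INF_unit luk_imp_unit) (auto simp: fuzzy_interp_def)
next
  case (CEx R C)
  then show ?case
    using assms(1) unfolding ceval.simps
    by (intro SUP_unit luk_and_unit) (auto simp: fuzzy_interp_def)
next
  case (CNot C)
  then show ?case by (fastforce simp: luk_not_def)
next
  case (COr C D)
  then show ?case by (fastforce simp: luk_or_def)
next
  case (CAnd C D)
  then show ?case using luk_and_unit by simp
qed (use assms(1) in \<open>auto simp: fuzzy_interp_def\<close>)

text \<open>Residuation: an implication has value 1 exactly when its premise is at most its
  conclusion.\<close>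

lemma subs_eval_ge_1_iff:
  assumes "fuzzy_interp \<I>"
  shows "subs_eval \<I> C D \<ge> 1 \<longleftrightarrow> (\<forall>x\<in>Dom \<I>. ceval \<I> C x \<le> ceval \<I> D x)"
proof -
  have "subs_eval \<I> C D \<ge> 1 \<longleftrightarrow> (\<forall>x\<in>Dom \<I>. luk_imp (ceval \<I> C x) (ceval \<I> D x) \<ge> 1)"
    unfolding subs_eval_def using assms
    by (intro le_cINF_iff bdd_below_unit luk_imp_unit ceval_unit) (auto simp: fuzzy_interp_def)
  then show ?thesis by (auto simp: luk_imp_def)
qed

lemma satisfies_K2_iff:
  assumes "fuzzy_interp \<I>"
  shows "satisfies \<I> (K2 A R a) \<longleftrightarrow>
    CN \<I> A (IN \<I> a) = 1/2 \<and>
    (\<forall>x\<in>Dom \<I>. 1 \<le> ceval \<I> (CEx R CTop) x) \<and>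
    (\<forall>x\<in>Dom \<I>. ceval \<I> (CAll R (CName A)) x = ceval \<I> (CEx R (CName A)) x) \<and>
    (\<forall>x\<in>Dom \<I>. CN \<I> A x =
      luk_and (ceval \<I> (CAll R (CName A)) x) (ceval \<I> (CAll R (CName A)) x))"
  unfolding satisfies_def K2_def Concept_eq_def Subsumed_def Equivalent_def
  by (simp add: subs_eval_ge_1_iff[OF assms] of_rat_divide del: ceval.simps(7,8))
    (simp add: ball_conj_distrib[symmetric] order_eq_iff del: ceval.simps(7,8); blast)

lemma CAll_le:
  assumes "fuzzy_interp \<I>" "x \<in> Dom \<I>" "y \<in> Dom \<I>"
  shows "ceval \<I> (CAll R C) x \<le> luk_imp (RN \<I> R x y) (ceval \<I> C y)"
  unfolding ceval.simps using assms
  by (intro cINF_lower bdd_below_unit luk_imp_unit ceval_unit) (auto simp: fuzzy_interp_def)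

lemma CEx_ge:
  assumes "fuzzy_interp \<I>" "x \<in> Dom \<I>" "y \<in> Dom \<I>"
  shows "luk_and (RN \<I> R x y) (ceval \<I> C y) \<le> ceval \<I> (CEx R C) x"
  unfolding ceval.simps using assms
  by (intro cSUP_upper bdd_above_unit luk_and_unit ceval_unit) (auto simp: fuzzy_interp_def)

section \<open>Finite models are impossible\<close>

lemma no_finite_model_K2:
  assumes I: "fuzzy_interp \<I>" and fin: "finite_interp \<I>"
  shows "\<not> satisfies \<I> (K2 A R a)"
proof
  assume "satisfies \<I> (K2 A R a)"
  then have half: "CN \<I> A (IN \<I> a) = 1/2"
    and total: "\<And>x. x \<in> Dom \<I> \<Longrightarrow> 1 \<le> ceval \<I> (CEx R CTop) x"
    and all_ex: "\<And>x. x \<in> Dom \<I> \<Longrightarrow>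
      ceval \<I> (CAll R (CName A)) x = ceval \<I> (CEx R (CName A)) x"
    and double: "\<And>x. x \<in> Dom \<I> \<Longrightarrow> CN \<I> A x =
      luk_and (ceval \<I> (CAll R (CName A)) x) (ceval \<I> (CAll R (CName A)) x)"
    by (auto simp: satisfies_K2_iff[OF I] simp del: ceval.simps(7,8))
  have fin: "finite (Dom \<I>)" and ne: "Dom \<I> \<noteq> {}" and a: "IN \<I> a \<in> Dom \<I>"
    using I fin by (auto simp: finite_interp_def fuzzy_interp_def)
  have succ: "\<exists>y\<in>Dom \<I>. CN \<I> A x = luk_and (CN \<I> A y) (CN \<I> A y)" if x: "x \<in> Dom \<I>" for x
  proof -
    let ?f = "\<lambda>y. luk_and (RN \<I> R x y) 1"
    have "ceval \<I> (CEx R CTop) x = Max (?f ` Dom \<I>)"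
      using fin ne by (simp add: cSup_eq_Max)
    also have "\<dots> \<in> ?f ` Dom \<I>"
      using fin ne by (intro Max_in) auto
    finally obtain y where y: "y \<in> Dom \<I>" "1 \<le> luk_and (RN \<I> R x y) 1"
      using total[OF x] by auto
    moreover have "RN \<I> R x y \<le> 1" "0 \<le> CN \<I> A y" "CN \<I> A y \<le> 1"
      using I x y(1) by (auto simp: fuzzy_interp_def)
    \<comment> \<open>Since 1 is neutral for \<open>luk_and\<close> and on the left of
      \<open>luk_imp\<close>, the value of \<open>A\<close> at \<open>y\<close> bounds the universal
      from above and the existential from below; \<open>all_ex\<close> makes them meet.\<close>
    ultimately have "ceval \<I> (CAll R (CName A)) x = CN \<I> A y"
      using CAll_le[OF I x y(1), of R "CName A"] CEx_ge[OF I x y(1), of R "CName A"] all_ex[OF x]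
      by (simp add: luk_and_def luk_imp_def del: ceval.simps(7,8))
    then show ?thesis using double[OF x] y(1) by auto
  qed
  define S where "S = {x \<in> Dom \<I>. 0 < CN \<I> A x \<and> CN \<I> A x < 1}"
  have "finite S" "S \<noteq> {}"
    using fin a half by (auto simp: S_def intro!: exI[of _ "IN \<I> a"])
  then have "Max (CN \<I> A ` S) \<in> CN \<I> A ` S" by (intro Max_in) auto
  then obtain x where x: "x \<in> S" and max: "\<And>y. y \<in> S \<Longrightarrow> CN \<I> A y \<le> CN \<I> A x"
    using \<open>finite S\<close> by (metis (no_types, lifting) Max_ge finite_imageI image_eqI imageE)
  obtain y where "y \<in> Dom \<I>" "CN \<I> A x = luk_and (CN \<I> A y) (CN \<I> A y)"
    using succ x by (auto simp: S_def)
  \<comment> \<open>As the value at \<open>x\<close> is positive, \<open>luk_and\<close> is not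
    truncated, and the value at \<open>y\<close> is the midpoint between the value at
    \<open>x\<close> and 1.\<close>
  then have "y \<in> S" "CN \<I> A x < CN \<I> A y"
    using x by (auto simp: S_def luk_and_def max_def split: if_splits)
  then show False using max by fastforce
qed

section \<open>Attained infima and crisp functional roles\<close>

lemma INF_attained:
  fixes f :: "nat \<Rightarrow> real"
  assumes "f \<longlonglongrightarrow> f k"
  shows "\<exists>n. (INF m. f m) = f n"
proof -
  have "\<exists>n. \<forall>m. f n \<le> f m"
  proof (cases "\<forall>m. f k \<le> f m")
    case False
    then obtain j where "f j < f k" by (auto simp: not_le)
    then obtain N where N: "\<And>n. n \<ge> N \<Longrightarrow> f j < f n"
      using order_tendstoD(1)[OF assms] by (auto simp: eventually_sequentially)
    obtain n where n: "\<And>m. m \<le> max j N \<Longrightarrow> f n \<le> f m"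
      using ex_is_arg_min_if_finite[of "{..max j N}" f]
      by (auto simp: is_arg_min_def not_less)
    \<comment> \<open>Beyond the initial segment, \<open>f m\<close> exceeds \<open>f j\<close>, and
      \<open>f j\<close> is at least \<open>f n\<close> because \<open>j\<close> lies in the
      segment.\<close>
    have "f n \<le> f m" for m
      using N[of m] n[of m] n[of j] by linarith
    then show ?thesis by blast
  qed blast
  then obtain n where "\<And>m. f n \<le> f m" by blast
  then have "(INF m. f m) = f n"
    by (intro cInf_eq_minimum) auto
  then show ?thesis ..
qed

text \<open>Every \<open>y\<close> other than \<open>z\<close> contributes 1, which cannot lower the
  infimum.\<close>

lemma INF_luk_imp_crisp:
  fixes f :: "'d \<Rightarrow> real"
  assumes "\<And>x. f x \<in> {0..1}"
  shows "(INF y. luk_imp (of_bool (y = z)) (f y)) = f z"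
proof (rule cInf_eq_minimum)
  show "f z \<in> range (\<lambda>y. luk_imp (of_bool (y = z)) (f y))"
    using assms[of z] by (auto simp: luk_imp_def image_iff intro!: exI[of _ z])
  show "f z \<le> u" if "u \<in> range (\<lambda>y. luk_imp (of_bool (y = z)) (f y))" for u
  proof -
    obtain y where "u = luk_imp (of_bool (y = z)) (f y)" using \<open>u \<in> _\<close> by blast
    then show ?thesis using assms[of z] assms[of y] by (cases "y = z") (auto simp: luk_imp_def)
  qed
qed

text \<open>Dually, every \<open>y\<close> other than \<open>z\<close> contributes 0.\<close>

lemma SUP_luk_and_crisp:
  fixes f :: "'d \<Rightarrow> real"
  assumes "\<And>x. f x \<in> {0..1}"
  shows "(SUP y. luk_and (of_bool (y = z)) (f y)) = f z"
proof (rule cSup_eq_maximum)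
  show "f z \<in> range (\<lambda>y. luk_and (of_bool (y = z)) (f y))"
    using assms[of z] by (auto simp: luk_and_def image_iff intro!: exI[of _ z])
  show "u \<le> f z" if "u \<in> range (\<lambda>y. luk_and (of_bool (y = z)) (f y))" for u
  proof -
    obtain y where "u = luk_and (of_bool (y = z)) (f y)" using \<open>u \<in> _\<close> by blast
    then show ?thesis using assms[of z] assms[of y] by (cases "y = z") (auto simp: luk_and_def)
  qed
qed

section \<open>The infinite witnessed model\<close>

text \<open>Element \<open>0\<close> is the limit point; the chain starts at element \<open>1\<close>.\<close>

definition chain_succ :: "nat \<Rightarrow> nat" where
  "chain_succ n = (if n = 0 then 0 else Suc n)"

definition chain_value :: "nat \<Rightarrow> real" where
  "chain_value n = (if n = 0 then 1 else 1 - (1/2) ^ n)"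

text \<open>All names of a kind are interpreted alike, so one model serves every choice of
  \<open>A\<close>, \<open>R\<close> and \<open>a\<close>; element 1 has value 1/2.\<close>

definition chain :: "('c, 'r, 'i, nat) interp" where
  "chain = \<lparr>Dom = UNIV, CN = (\<lambda>_. chain_value), RN = (\<lambda>_ x y. of_bool (y = chain_succ x)),
     IN = (\<lambda>_. 1)\<rparr>"

lemma chain_simps [simp]:
  "Dom chain = UNIV" "CN chain A = chain_value" "IN chain a = 1"
  "RN chain R x y = of_bool (y = chain_succ x)"
  by (simp_all add: chain_def)

lemma fuzzy_interp_chain: "fuzzy_interp chain"
  by (auto simp: fuzzy_interp_def chain_value_def power_le_one)

lemma ceval_chain_CAll:
  "ceval (chain :: ('c, 'r, 'i, nat) interp) (CAll R C) x =
    ceval (chain :: ('c, 'r, 'i, nat) interp) C (chain_succ x)"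
  unfolding ceval.simps chain_simps
  by (intro INF_luk_imp_crisp ceval_unit[OF fuzzy_interp_chain]) simp

lemma ceval_chain_CEx:
  "ceval (chain :: ('c, 'r, 'i, nat) interp) (CEx R C) x =
    ceval (chain :: ('c, 'r, 'i, nat) interp) C (chain_succ x)"
  unfolding ceval.simps chain_simps
  by (intro SUP_luk_and_crisp ceval_unit[OF fuzzy_interp_chain]) simp

text \<open>The connectives are continuous, and both quantifiers merely shift the sequence by
  \<open>chain_succ\<close>, which fixes 0.\<close>

lemma ceval_chain_tendsto:
  "ceval (chain :: ('c, 'r, 'i, nat) interp) C \<longlonglongrightarrow>
    ceval (chain :: ('c, 'r, 'i, nat) interp) C 0"
  (is "ceval ?I C \<longlonglongrightarrow> _")
proof (induction C)
  case (CName A)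
  have "(\<lambda>n. 1 - (1/2) ^ n :: real) \<longlonglongrightarrow> 1 - 0"
    by (intro tendsto_intros LIMSEQ_power_zero) auto
  moreover have "eventually (\<lambda>n. 1 - (1/2) ^ n = chain_value n) sequentially"
    using eventually_gt_at_top[of 0] by eventually_elim (simp add: chain_value_def)
  ultimately show ?case
    by (auto simp: chain_value_def[of 0] intro: Lim_transform_eventually)
next
  case (CAll R C)
  have "(\<lambda>n. ceval ?I C (chain_succ n)) \<longlonglongrightarrow> ceval ?I C 0"
    \<comment> \<open>\<open>chain_succ\<close> agrees with \<open>Suc\<close> only from 1 on, hence
      the eventual equality.\<close>
    by (rule Lim_transform_eventually[OF LIMSEQ_Suc[OF CAll]])
      (auto simp: chain_succ_def eventually_sequentially intro!: exI[of _ 1])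
  then show ?case unfolding ceval_chain_CAll by (simp add: chain_succ_def[of 0])
next
  case (CEx R C)
  have "(\<lambda>n. ceval ?I C (chain_succ n)) \<longlonglongrightarrow> ceval ?I C 0"
    by (rule Lim_transform_eventually[OF LIMSEQ_Suc[OF CEx]])
      (auto simp: chain_succ_def eventually_sequentially intro!: exI[of _ 1])
  then show ?case unfolding ceval_chain_CEx by (simp add: chain_succ_def[of 0])
qed (auto simp: luk_and_def luk_or_def luk_not_def intro!: tendsto_intros)

lemma witnessed_chain: "witnessed (chain :: ('c, 'r, 'i, nat) interp)"
  (is "witnessed ?I")
  unfolding witnessed_def
proof (intro allI ballI conjI)
  fix C D :: "('c, 'r) concept" and R :: 'r and x :: nat
  have unit: "ceval ?I C y \<in> {0..1}" for y
    using ceval_unit[OF fuzzy_interp_chain] by simp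
  show "\<exists>y\<in>Dom ?I. ceval ?I (CEx R C) x = luk_and (RN ?I R x y) (ceval ?I C y)"
    using unit[of "chain_succ x"] unfolding ceval_chain_CEx
    by (auto simp: luk_and_def intro!: exI[of _ "chain_succ x"])
  show "\<exists>y\<in>Dom ?I. ceval ?I (CAll R C) x = luk_imp (RN ?I R x y) (ceval ?I C y)"
    using unit[of "chain_succ x"] unfolding ceval_chain_CAll
    by (auto simp: luk_imp_def intro!: exI[of _ "chain_succ x"])
  have "(\<lambda>n. luk_imp (ceval ?I C n) (ceval ?I D n)) \<longlonglongrightarrow>
      luk_imp (ceval ?I C 0) (ceval ?I D 0)"
    unfolding luk_imp_def by (intro tendsto_intros ceval_chain_tendsto)
  then show "\<exists>y\<in>Dom ?I. subs_eval ?I C D = luk_imp (ceval ?I C y) (ceval ?I D y)"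
    using INF_attained[where f = "\<lambda>n. luk_imp (ceval ?I C n) (ceval ?I D n)" and k = 0]
    by (simp add: subs_eval_def)
qed

text \<open>Both quantifiers evaluate at the successor, which gives (3); (4) holds because doubling
  \<open>1 - (1/2) ^ Suc n\<close> and subtracting 1 gives \<open>1 - (1/2) ^ n\<close>, and 1 is a
  fixed point.\<close>

lemma satisfies_chain: "satisfies chain (K2 A R a)"
  unfolding satisfies_K2_iff[OF fuzzy_interp_chain] ceval_chain_CAll ceval_chain_CEx
  by (auto simp: chain_value_def chain_succ_def luk_and_def power_le_one)

theorem theorem3p3:
  fixes A :: "'c::countable" and R :: "'r::countable" and a :: "'i::countable"
  shows "(\<exists>\<I> :: ('c, 'r, 'i, nat) interp.
            fuzzy_interp \<I> \<and> witnessed \<I> \<and> satisfies \<I> (K2 A R a)) \<and>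
         \<not> (\<exists>\<J> :: ('c, 'r, 'i, 'd) interp.
            fuzzy_interp \<J> \<and> finite_interp \<J> \<and> satisfies \<J> (K2 A R a))"
  by (intro conjI exI[of _ chain] fuzzy_interp_chain witnessed_chain satisfies_chain)
    (blast dest: no_finite_model_K2)

end
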